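(* Let $\mathbb F$ be an algebraically closed field of characteristic $2$ and let $\mathcal H$ be the Heisenberg Lie algebra over $\mathbb F$ with basis $x,y,z$ and bracket $[x,y]=z$, $z$ central. Up to isomorphism of restricted Lie algebras there are exactly two restricted Heisenberg algebras: every $(\mathcal H,\theta)$ is isomorphic to exactly one of the non-isomorphic restricted Lie algebras $(\mathcal H,0)$ and $(\mathcal H,z^* )$.
   Context: A restricted Lie algebra in characteristic $2$ is a Lie algebra $L$ with a map $(\cdot)^{[2]}:L\to L$ such that $(\lambda x)^{[2]}=\lambda^2x^{[2]}$, $[x,y^{[2]}]=[[x,y],y]$, $(x+y)^{[2]}=x^{[2]}+y^{[2]}+[x,y]$. An isomorphism of restricted Lie algebras is a Lie isomorphism commuting with the $2$-maps. For a linear form $\theta:\mathcal H\to\mathbb F$, $(\mathcal H,\theta)$ denotes $\mathcal H$ with the $2$-map determined by $x^{[2]}=\theta(x)z$, $y^{[2]}=\theta(y)z$, $z^{[2]}=\theta(z)z$, i.e. $(ax+by+cz)^{[2]}=(a^2\theta(x)+b^2\theta(y)+c^2\theta(z)+ab)z$; every $2$-map on $\mathcal H$ is of this form. $z^*$ is the linear form with $z^*(x)=z^*(y)=0$, $z^*(z)=1$. *)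

theory Defs
  imports "HOL-Analysis.Analysis" "HOL-Computational_Algebra.Computational_Algebra"
begin

locale lie_algebra = vector_space scale
  for scale :: "'f::field \<Rightarrow> 'v::ab_group_add \<Rightarrow> 'v" +
  fixes bracket :: "'v \<Rightarrow> 'v \<Rightarrow> 'v"
  assumes bracket_add_left: "bracket (u + v) w = bracket u w + bracket v w"
    and bracket_add_right: "bracket u (v + w) = bracket u v + bracket u w"
    and bracket_scale_left: "bracket (scale c u) v = scale c (bracket u v)"
    and bracket_scale_right: "bracket u (scale c v) = scale c (bracket u v)"
    and bracket_self: "bracket u u = 0"
    and jacobi: "bracket u (bracket v w) + bracket v (bracket w u) + bracket w (bracket u v) = 0"

locale restricted_lie_algebra_2 = lie_algebra scale bracket
  for scale :: "'f::field \<Rightarrow> 'v::ab_group_add \<Rightarrow> 'v" and bracket +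
  fixes two_map :: "'v \<Rightarrow> 'v"
  assumes char_2: "CHAR('f) = 2"
    and two_map_scale: "two_map (scale c u) = scale (c\<^sup>2) (two_map u)"
    and bracket_two_map: "bracket u (two_map v) = bracket (bracket u v) v"
    and two_map_add: "two_map (u + v) = two_map u + two_map v + bracket u v"

definition restricted_lie_isomorphic ::
  "('f::field \<Rightarrow> 'v::ab_group_add \<Rightarrow> 'v) \<Rightarrow> ('v \<Rightarrow> 'v \<Rightarrow> 'v) \<Rightarrow> ('v \<Rightarrow> 'v) \<Rightarrow>
   ('f \<Rightarrow> 'w::ab_group_add \<Rightarrow> 'w) \<Rightarrow> ('w \<Rightarrow> 'w \<Rightarrow> 'w) \<Rightarrow> ('w \<Rightarrow> 'w) \<Rightarrow> bool" where
  "restricted_lie_isomorphic s1 b1 t1 s2 b2 t2 \<longleftrightarrow>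
    (\<exists>\<phi>. Vector_Spaces.linear s1 s2 \<phi> \<and> bij \<phi> \<and>
      (\<forall>u v. \<phi> (b1 u v) = b2 (\<phi> u) (\<phi> v)) \<and> (\<forall>u. \<phi> (t1 u) = t2 (\<phi> u)))"

text \<open>The Heisenberg Lie algebra is modelled on triples: \<open>u\<close> stands for
  \<open>(u $ 1) x + (u $ 2) y + (u $ 3) z\<close>.\<close>

definition heis_x :: "'f::field ^ 3" where "heis_x = axis 1 1"
definition heis_y :: "'f::field ^ 3" where "heis_y = axis 2 1"
definition heis_z :: "'f::field ^ 3" where "heis_z = axis 3 1"

definition heis_bracket :: "'f::field ^ 3 \<Rightarrow> 'f ^ 3 \<Rightarrow> 'f ^ 3" where
  "heis_bracket u v = (u $ 1 * v $ 2 - u $ 2 * v $ 1) *s heis_z"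

definition heis_two_map :: "('f::field ^ 3 \<Rightarrow> 'f) \<Rightarrow> 'f ^ 3 \<Rightarrow> 'f ^ 3" where
  "heis_two_map \<theta> u =
    ((u $ 1)\<^sup>2 * \<theta> heis_x + (u $ 2)\<^sup>2 * \<theta> heis_y + (u $ 3)\<^sup>2 * \<theta> heis_z + u $ 1 * u $ 2) *s heis_z"

definition z_star :: "'f::field ^ 3 \<Rightarrow> 'f" where
  "z_star u = u $ 3"

text \<open>Isomorphism between the Heisenberg algebra with two given 2-maps.\<close>

definition heis_isomorphic :: "('f::field ^ 3 \<Rightarrow> 'f ^ 3) \<Rightarrow> ('f ^ 3 \<Rightarrow> 'f ^ 3) \<Rightarrow> bool" where
  "heis_isomorphic s t \<longleftrightarrow>
    restricted_lie_isomorphic (*s) heis_bracket s (*s) heis_bracket t"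

lemma heis_basis_nth [simp]:
  "heis_x $ 1 = 1" "heis_x $ 2 = 0" "heis_x $ 3 = 0"
  "heis_y $ 1 = 0" "heis_y $ 2 = 1" "heis_y $ 3 = 0"
  "heis_z $ 1 = 0" "heis_z $ 2 = 0" "heis_z $ 3 = 1"
  by (simp_all add: heis_x_def heis_y_def heis_z_def axis_def)

lemma heis_expand: "u = u $ 1 *s heis_x + u $ 2 *s heis_y + u $ 3 *s heis_z"
  by (simp add: vec_eq_iff forall_3)

lemma heis_bracket_basis:
  "heis_bracket heis_x heis_y = heis_z" "heis_bracket u heis_z = 0" "heis_bracket heis_z u = 0"
  by (simp_all add: heis_bracket_def vec_eq_iff forall_3)

lemma lie_algebra_heis: "lie_algebra ((*s) :: 'f::field \<Rightarrow> _) heis_bracket"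
  by unfold_locales (simp_all add: heis_bracket_def vec_eq_iff forall_3 algebra_simps)

lemma restricted_heis_two_map:
  assumes "CHAR('f::field) = 2"
  shows "restricted_lie_algebra_2 ((*s) :: 'f \<Rightarrow> _) heis_bracket (heis_two_map \<theta>)"
proof -
  have two: "(2 :: 'f) = 0"
    using assms of_nat_CHAR [where 'a = 'f] by simp
  interpret lie_algebra "(*s) :: 'f \<Rightarrow> _" heis_bracket by (rule lie_algebra_heis)
  have neg: "- a = a" for a :: 'f
    using two by (metis add_eq_0_iff mult_2 mult_zero_left)
  show ?thesis
    by unfold_locales
      (simp_all add: assms two neg heis_bracket_def heis_two_map_def vec_eq_iff forall_3
        power2_eq_square diff_conv_add_uminus algebra_simps del: add_uminus_conv_diff,
       (simp add: two neg flip: mult_2)?)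
qed

lemma z_star_linear: "Vector_Spaces.linear (*s) (*) (z_star :: 'f::field ^ 3 \<Rightarrow> 'f)"
  by (rule Vector_Spaces.linear.intro)
    (unfold_locales, simp_all add: z_star_def algebra_simps)

end

theory Submission
  imports Defs
begin

text \<open>Every 2-map has central values, so it is determined by its values on the basis, i.e. it is
  some \<open>heis_two_map \<theta>\<close>. An automorphism of the Lie algebra multiplies \<open>z\<close> by a nonzero
  scalar, so whether \<open>\<theta> z\<close> vanishes is an isomorphism invariant. Over an algebraically closed field
  it is the only one: if \<open>\<theta> z = 0\<close>, the quadratic form \<open>a\<^sup>2 \<theta> x + a b + b\<^sup>2 \<theta> y\<close> splits into two linear
  factors of determinant 1; if \<open>\<theta> z \<noteq> 0\<close>, the square terms are absorbed in \<open>c\<^sup>2\<close>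
  because squaring is additive and surjective.\<close>

no_notation fps_nth (infixl "$" 75)

lemma heis_isomorphic_iff:
  "heis_isomorphic t t' \<longleftrightarrow> (\<exists>\<phi>. Vector_Spaces.linear (*s) (*s) \<phi> \<and> bij \<phi> \<and>
    (\<forall>u v. \<phi> (heis_bracket u v) = heis_bracket (\<phi> u) (\<phi> v)) \<and> (\<forall>u. \<phi> (t u) = t' (\<phi> u)))"
  by (simp add: heis_isomorphic_def restricted_lie_isomorphic_def)

text \<open>The isomorphism has a matrix whose upper left block has rows \<open>(p, q)\<close> and
  \<open>(r, s)\<close>. Since \<open>heis_z\<close> is the bracket of \<open>heis_x\<close> and
  \<open>heis_y\<close>, its image must be the block determinant \<open>d\<close> times
  \<open>heis_z\<close>; \<alpha> and \<beta> remain free. \<open>compat\<close> is compatibility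
  with the 2-maps, written in coordinates.\<close>

lemma heis_isomorphic_two_mapI:
  fixes p q r s \<alpha> \<beta> :: "'f::field"
  defines "d \<equiv> p * s - q * r"
  assumes d: "d \<noteq> 0"
    and compat: "\<And>a b c. d * (a\<^sup>2 * \<theta> heis_x + b\<^sup>2 * \<theta> heis_y + c\<^sup>2 * \<theta> heis_z + a * b) =
      (p * a + q * b)\<^sup>2 * \<eta> heis_x + (r * a + s * b)\<^sup>2 * \<eta> heis_y +
      (\<alpha> * a + \<beta> * b + d * c)\<^sup>2 * \<eta> heis_z + (p * a + q * b) * (r * a + s * b)"
  shows "heis_isomorphic (heis_two_map \<theta>) (heis_two_map \<eta>)"
proof -
  define \<phi> :: "'f ^ 3 \<Rightarrow> 'f ^ 3" where
    "\<phi> = (\<lambda>u. vector [p * u $ 1 + q * u $ 2, r * u $ 1 + s * u $ 2, \<alpha> * u $ 1 + \<beta> * u $ 2 + d * u $ 3])"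
  have lin: "Vector_Spaces.linear (*s) (*s) \<phi>"
    by (rule Vector_Spaces.linear.intro)
      (unfold_locales, simp_all add: \<phi>_def vec_eq_iff forall_3 algebra_simps)
  have "u = 0" if "\<phi> u = 0" for u
  proof -
    have eqs: "p * u $ 1 + q * u $ 2 = 0" "r * u $ 1 + s * u $ 2 = 0"
        "\<alpha> * u $ 1 + \<beta> * u $ 2 + d * u $ 3 = 0"
      using that by (simp_all add: \<phi>_def vec_eq_iff forall_3)
    \<comment> \<open>Cramer's rule: multiplying by the adjugate of the block isolates the first two
      coordinates.\<close>
    have "d * u $ 1 = s * (p * u $ 1 + q * u $ 2) - q * (r * u $ 1 + s * u $ 2)"
      "d * u $ 2 = p * (r * u $ 1 + s * u $ 2) - r * (p * u $ 1 + q * u $ 2)"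
      by (simp_all add: d_def algebra_simps)
    then have "u $ 1 = 0" "u $ 2 = 0"
      using d by (simp_all only: eqs) simp_all
    with d eqs(3) show ?thesis
      by (simp add: vec_eq_iff forall_3)
  qed
  then have "inj \<phi>"
    using vec.linear_inj_iff_eq_0[OF lin] by blast
  then have "bij \<phi>"
    using vec.linear_injective_imp_surjective[OF lin] by (simp add: bij_def)
  moreover have "\<phi> (heis_bracket u v) = heis_bracket (\<phi> u) (\<phi> v)" for u v
    by (simp add: \<phi>_def heis_bracket_def d_def vec_eq_iff forall_3 algebra_simps)
  moreover have "\<phi> (heis_two_map \<theta> u) = heis_two_map \<eta> (\<phi> u)" for u
    using compat[of "u $ 1" "u $ 2" "u $ 3"]
    by (simp add: \<phi>_def heis_two_map_def vec_eq_iff forall_3)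
  ultimately show ?thesis
    using lin unfolding heis_isomorphic_iff by blast
qed

lemma heis_isomorphic_two_map_zero_iff:
  fixes \<theta> \<eta> :: "'f::field ^ 3 \<Rightarrow> 'f"
  assumes "heis_isomorphic (heis_two_map \<theta>) (heis_two_map \<eta>)"
  shows "\<theta> heis_z = 0 \<longleftrightarrow> \<eta> heis_z = 0"
proof -
  obtain \<phi> where lin: "Vector_Spaces.linear (*s) (*s) \<phi>" and "bij \<phi>"
    and br: "\<And>u v. \<phi> (heis_bracket u v) = heis_bracket (\<phi> u) (\<phi> v)"
    and tm: "\<And>u. \<phi> (heis_two_map \<theta> u) = heis_two_map \<eta> (\<phi> u)"
    using assms unfolding heis_isomorphic_iff by blast
  interpret Vector_Spaces.linear "(*s)" "(*s)" \<phi> by (rule lin)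
  have "\<phi> heis_z = heis_bracket (\<phi> heis_x) (\<phi> heis_y)"
    using br[of heis_x heis_y] by (simp only: heis_bracket_basis)
  then obtain d where d: "\<phi> heis_z = d *s heis_z"
    unfolding heis_bracket_def by blast
  have "d \<noteq> 0"
  proof
    assume "d = 0"
    then have "\<phi> heis_z = \<phi> 0"
      using d zero by simp
    then have "(heis_z :: 'f ^ 3) = 0"
      using bij_is_inj[OF \<open>bij \<phi>\<close>] by (rule injD[rotated])
    then have "(heis_z :: 'f ^ 3) $ 3 = 0"
      by simp
    then show False by simp
  qed
  \<comment> \<open>Both sides are the third coordinate of the image of the 2-power of
    \<open>heis_z\<close>; the 2-map squares the scalar \<open>d\<close>, while \<phi> is
    linear.\<close>
  moreover have "\<theta> heis_z * d = d\<^sup>2 * \<eta> heis_z"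
    using tm[of heis_z] by (simp add: heis_two_map_def scale d vec_eq_iff forall_3)
  ultimately show ?thesis
    by auto
qed

lemma restricted_heis_two_map_cases:
  fixes t :: "'f::field ^ 3 \<Rightarrow> 'f ^ 3"
  assumes "restricted_lie_algebra_2 (*s) heis_bracket t"
  obtains \<theta> where "t = heis_two_map \<theta>"
proof
  interpret restricted_lie_algebra_2 "(*s)" heis_bracket t by (rule assms)
  \<comment> \<open>\<open>[u, t v] = [[u, v], v]\<close> vanishes because every bracket is central.
    Taking \<open>u\<close> to be \<open>heis_x\<close> reads off the second coordinate of
    \<open>t v\<close>, and \<open>heis_y\<close> the first.\<close>
  have central: "t v $ 1 = 0" "t v $ 2 = 0" for v
    using bracket_two_map[of heis_x v] bracket_two_map[of heis_y v]
    by (simp_all add: heis_bracket_def vec_eq_iff forall_3)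
  \<comment> \<open>\<open>heis_two_map\<close> evaluates its form only at the basis vectors, so the
    third coordinate of \<open>t\<close> can be supplied directly.\<close>
  show "t = heis_two_map (\<lambda>u. t u $ 3)"
  proof
    fix u
    have "t u = t (u $ 1 *s heis_x + u $ 2 *s heis_y + u $ 3 *s heis_z)"
      using heis_expand[of u] by simp
    then show "t u = heis_two_map (\<lambda>u. t u $ 3) u"
      by (simp add: two_map_add two_map_scale central heis_bracket_def heis_two_map_def
          vec_eq_iff forall_3)
  qed
qed

lemma heis_isomorphic_two_map_0:
  fixes \<theta> :: "'f::alg_closed_field ^ 3 \<Rightarrow> 'f"
  assumes char: "CHAR('f) = 2" and z: "\<theta> heis_z = 0"
  shows "heis_isomorphic (heis_two_map \<theta>) (heis_two_map (\<lambda>_. 0))"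
proof -
  let ?A = "\<theta> heis_x" and ?B = "\<theta> heis_y"
  have two: "(2 :: 'f) = 0"
    using char of_nat_CHAR[where 'a = 'f] by simp
  \<comment> \<open>The linear coefficient 1 keeps the degree positive even if \<open>?A\<close> is
    0, so a root exists in every case.\<close>
  have "\<exists>s. poly [:?B, 1, ?A:] s = 0"
    by (rule alg_closed_imp_poly_has_root) simp
  then obtain s where s: "?B + s + ?A * s\<^sup>2 = 0"
    by (auto simp: algebra_simps power2_eq_square)
  have B: "?B = ?A * s\<^sup>2 + s"
  proof -
    have "?B = (?B + s + ?A * s\<^sup>2) + (?A * s\<^sup>2 + s) - 2 * (?A * s\<^sup>2 + s)"
      by (simp add: algebra_simps)
    also have "\<dots> = ?A * s\<^sup>2 + s"
      unfolding s two by simp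
    finally show ?thesis .
  qed
  \<comment> \<open>The product has cross term \<open>(2 * ?A * s + 1) * a * b\<close>, which is
    \<open>a * b\<close> in characteristic 2.\<close>
  have fac: "a\<^sup>2 * ?A + b\<^sup>2 * ?B + a * b = (a + s * b) * (?A * a + (?A * s + 1) * b)" for a b
  proof -
    have "(a + s * b) * (?A * a + (?A * s + 1) * b) =
        a\<^sup>2 * ?A + b\<^sup>2 * (?A * s\<^sup>2 + s) + a * b + 2 * (?A * s * a * b)"
      by (simp add: algebra_simps power2_eq_square)
    also have "\<dots> = a\<^sup>2 * ?A + b\<^sup>2 * ?B + a * b"
      unfolding B two by simp
    finally show ?thesis ..
  qed
  have det: "1 * (?A * s + 1) - s * ?A = 1"
    by simp
  show ?thesis
  \<comment> \<open>The two linear factors become the new first two coordinates, since the target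
    2-map has only the product of these coordinates.\<close>
  proof (rule heis_isomorphic_two_mapI[where p = 1 and q = s and r = ?A and s = "?A * s + 1"
        and \<alpha> = 0 and \<beta> = 0], unfold det)
    show "1 * (a\<^sup>2 * ?A + b\<^sup>2 * ?B + c\<^sup>2 * \<theta> heis_z + a * b) =
        (1 * a + s * b)\<^sup>2 * 0 + (?A * a + (?A * s + 1) * b)\<^sup>2 * 0 + (0 * a + 0 * b + 1 * c)\<^sup>2 * 0 +
        (1 * a + s * b) * (?A * a + (?A * s + 1) * b)" for a b c
      using fac[of a b] by (simp only: z mult_1 mult_zero_left mult_zero_right add_0 add_0_right)
  qed simp
qed

lemma heis_isomorphic_two_map_z_star:
  fixes \<theta> :: "'f::alg_closed_field ^ 3 \<Rightarrow> 'f"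
  assumes char: "CHAR('f) = 2" and z: "\<theta> heis_z \<noteq> 0"
  shows "heis_isomorphic (heis_two_map \<theta>) (heis_two_map z_star)"
proof -
  let ?C = "\<theta> heis_z"
  have two: "(2 :: 'f) = 0"
    using char of_nat_CHAR[where 'a = 'f] by simp
  \<comment> \<open>Multiplied by \<open>?C\<close>, the term in \<open>c\<close> becomes the square
    of \<open>?C * c\<close>; these roots make the other two square terms squares as well.\<close>
  obtain \<alpha> \<beta> where sqrts: "\<alpha>\<^sup>2 = ?C * \<theta> heis_x" "\<beta>\<^sup>2 = ?C * \<theta> heis_y"
    using nth_root_exists[of 2 "?C * \<theta> heis_x"] nth_root_exists[of 2 "?C * \<theta> heis_y"] by auto
  have complete_square: "?C * (a\<^sup>2 * \<theta> heis_x + b\<^sup>2 * \<theta> heis_y + c\<^sup>2 * ?C + a * b) =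
      (\<alpha> * a + \<beta> * b + ?C * c)\<^sup>2 + ?C * a * b" for a b c
  proof -
    have "(\<alpha> * a + \<beta> * b + ?C * c)\<^sup>2 = \<alpha>\<^sup>2 * a\<^sup>2 + \<beta>\<^sup>2 * b\<^sup>2 + ?C\<^sup>2 * c\<^sup>2 +
        2 * (\<alpha> * a * \<beta> * b + \<alpha> * a * ?C * c + \<beta> * b * ?C * c)"
      by (simp add: algebra_simps power2_eq_square)
    also have "\<dots> = ?C * (a\<^sup>2 * \<theta> heis_x + b\<^sup>2 * \<theta> heis_y + c\<^sup>2 * ?C)"
      by (simp only: two sqrts) (simp add: algebra_simps power2_eq_square)
    finally show ?thesis
      by (simp add: algebra_simps)
  qed
  show ?thesis
  \<comment> \<open>Scaling the first coordinate by \<open>?C\<close> gives determinant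
    \<open>?C\<close>, exactly the factor used to complete the square.\<close>
  proof (rule heis_isomorphic_two_mapI[where p = ?C and q = 0 and r = 0 and s = 1
        and \<alpha> = \<alpha> and \<beta> = \<beta>])
    have det: "?C * 1 - 0 * 0 = ?C"
      by simp
    show "(?C * 1 - 0 * 0) * (a\<^sup>2 * \<theta> heis_x + b\<^sup>2 * \<theta> heis_y + c\<^sup>2 * ?C + a * b) =
        (?C * a + 0 * b)\<^sup>2 * z_star heis_x + (0 * a + 1 * b)\<^sup>2 * z_star heis_y +
        (\<alpha> * a + \<beta> * b + (?C * 1 - 0 * 0) * c)\<^sup>2 * z_star heis_z +
        (?C * a + 0 * b) * (0 * a + 1 * b)" for a b c
      unfolding det complete_square by (simp add: z_star_def)
  qed (use z in simp)
qed

text \<open>The inequality of truth values is an exclusive or. In each case one isomorphism has been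
  constructed, and the invariant at \<open>heis_z\<close> excludes the other.\<close>

lemma heis_isomorphic_two_map_exclusive:
  fixes \<theta> :: "'f::alg_closed_field ^ 3 \<Rightarrow> 'f"
  assumes "CHAR('f) = 2"
  shows "heis_isomorphic (heis_two_map \<theta>) (heis_two_map (\<lambda>_. 0)) \<noteq>
    heis_isomorphic (heis_two_map \<theta>) (heis_two_map z_star)"
proof (cases "\<theta> heis_z = 0")
  case True
  have "\<not> heis_isomorphic (heis_two_map \<theta>) (heis_two_map z_star)"
    using heis_isomorphic_two_map_zero_iff[of \<theta> z_star] True by (auto simp: z_star_def)
  then show ?thesis
    using heis_isomorphic_two_map_0[of \<theta>, OF assms True] by blast
next
  case False
  have "\<not> heis_isomorphic (heis_two_map \<theta>) (heis_two_map (\<lambda>_. 0))"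
    using heis_isomorphic_two_map_zero_iff[of \<theta> "\<lambda>_. 0"] False by auto
  then show ?thesis
    using heis_isomorphic_two_map_z_star[of \<theta>, OF assms False] by blast
qed

theorem theorem5p11:
  assumes "CHAR('f::alg_closed_field) = 2"
  shows
    "restricted_lie_algebra_2 (*s) heis_bracket (heis_two_map (\<lambda>_ :: 'f ^ 3. 0 :: 'f)) \<and>
     restricted_lie_algebra_2 (*s) heis_bracket (heis_two_map (z_star :: 'f ^ 3 \<Rightarrow> 'f)) \<and>
     \<not> heis_isomorphic (heis_two_map (\<lambda>_ :: 'f ^ 3. 0 :: 'f)) (heis_two_map z_star) \<and>
     (\<forall>\<theta> :: 'f ^ 3 \<Rightarrow> 'f. Vector_Spaces.linear (*s) (*) \<theta> \<longrightarrow>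
        restricted_lie_algebra_2 (*s) heis_bracket (heis_two_map \<theta>) \<and>
        (heis_isomorphic (heis_two_map \<theta>) (heis_two_map (\<lambda>_. 0)) \<noteq>
         heis_isomorphic (heis_two_map \<theta>) (heis_two_map z_star))) \<and>
     (\<forall>t :: 'f ^ 3 \<Rightarrow> 'f ^ 3. restricted_lie_algebra_2 (*s) heis_bracket t \<longrightarrow>
        (heis_isomorphic t (heis_two_map (\<lambda>_. 0)) \<noteq>
         heis_isomorphic t (heis_two_map z_star)))"
proof (intro conjI allI impI)
  show "\<not> heis_isomorphic (heis_two_map (\<lambda>_ :: 'f ^ 3. 0 :: 'f)) (heis_two_map z_star)"
    using heis_isomorphic_two_map_zero_iff[of "\<lambda>_ :: 'f ^ 3. 0 :: 'f" z_star]
    by (auto simp: z_star_def)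
next
  fix t :: "'f ^ 3 \<Rightarrow> 'f ^ 3"
  assume "restricted_lie_algebra_2 (*s) heis_bracket t"
  then obtain \<theta> where "t = heis_two_map \<theta>"
    by (rule restricted_heis_two_map_cases)
  then show "heis_isomorphic t (heis_two_map (\<lambda>_. 0)) \<noteq> heis_isomorphic t (heis_two_map z_star)"
    using heis_isomorphic_two_map_exclusive[OF assms] by simp
qed (rule restricted_heis_two_map[OF assms] heis_isomorphic_two_map_exclusive[OF assms])+

end
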